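(* Let $G$ be a finite simple graph and let $M$ and $N$ be matchings of $G$ with $M\subset N$. Then $d(M)\le d(N)$.
   Context: A matching of $G=(V,E)$ is a set of pairwise disjoint edges (the empty set included). The matching polytope $\mathcal{M}(G)$ is the convex hull of the incidence vectors $\chi_M\in\mathbb{R}^E$ of all matchings $M$ of $G$ (these are exactly its vertices); the skeleton $\mathcal{G}(\mathcal{M}(G))$ is the graph of vertices and edges (1-dimensional faces) of $\mathcal{M}(G)$, and $d(M)$ is the degree of $\chi_M$ in the skeleton. *)

theory Defs
  imports "HOL-Analysis.Analysis"
begin

definition simple_graph :: "'v set \<Rightarrow> 'v set set \<Rightarrow> bool" where
  "simple_graph V E \<longleftrightarrow> finite V \<and> E \<subseteq> {e. e \<subseteq> V \<and> card e = 2}"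

definition matching :: "'v set set \<Rightarrow> 'v set set \<Rightarrow> bool" where
  "matching E M \<longleftrightarrow> M \<subseteq> E \<and> pairwise disjnt M"

text \<open>
  The space \<open>\<real>\<^sup>E\<close> is the coordinate subspace of \<open>real ^ ('v set)\<close> of vectors vanishing at all
  indices outside \<open>E\<close>. Since the vectors of all matchings lie in it, the polytope, its faces and
  their dimensions do not depend on the extra coordinates.
\<close>

definition incidence_vector :: "'v::finite set set \<Rightarrow> real ^ ('v set)" where
  "incidence_vector M = (\<chi> e. if e \<in> M then 1 else 0)"

definition matching_polytope :: "'v::finite set set \<Rightarrow> (real ^ ('v set)) set" where
  "matching_polytope E = convex hull (incidence_vector ` {M. matching E M})"

definition skeleton_vertices :: "'a::euclidean_space set \<Rightarrow> 'a set" where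
  "skeleton_vertices P = {x. x extreme_point_of P}"

definition skeleton_edges :: "'a::euclidean_space set \<Rightarrow> 'a set set" where
  "skeleton_edges P =
     {{x, y} | x y. x \<in> skeleton_vertices P \<and> y \<in> skeleton_vertices P \<and>
                    closed_segment x y edge_of P}"

definition degree_in :: "'a set set \<Rightarrow> 'a \<Rightarrow> nat" where
  "degree_in E v = card {e \<in> E. v \<in> e}"

definition matching_degree :: "'v::finite set set \<Rightarrow> 'v set set \<Rightarrow> nat" where
  "matching_degree E M = degree_in (skeleton_edges (matching_polytope E)) (incidence_vector M)"

end

theory Submission imports Defs begin

text \<open>
  Two matchings are adjacent in the skeleton iff some edge weighting is maximised, over all
  matchings, exactly at these two. It suffices to treat \<open>N = M \<union> {e}\<close>. Given a neighbour \<open>M'\<close> of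
  \<open>M\<close>, the matching \<open>N\<close> is adjacent to \<open>M\<close> if \<open>M' = N\<close>, to \<open>M' \<union> {e}\<close> if \<open>M'\<close> misses both ends
  of \<open>e\<close>, and to \<open>M'\<close> itself otherwise. In the last two cases a weighting for \<open>{M, M'}\<close> is turned
  into one for the new pair by rewarding the ends of \<open>e\<close> covered by \<open>M'\<close> and giving \<open>e\<close> a weight
  equal to the total reward (or 1 if there is none). The resulting assignment of neighbours is injective.
\<close>

section \<open>Adjacency of matchings through edge weightings\<close>

definition adjacent_matchings :: "'v set set \<Rightarrow> 'v set set \<Rightarrow> 'v set set \<Rightarrow> bool" where
  "adjacent_matchings E M M' \<longleftrightarrow> M \<noteq> M' \<and> matching E M \<and> matching E M' \<and>
     (\<exists>(c :: 'v set \<Rightarrow> real) b. \<forall>A. matching E A \<longrightarrow> sum c A \<le> b \<and> (sum c A = b \<longleftrightarrow> A = M \<or> A = M'))"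

lemma adjacent_matchings_weightE:
  fixes E :: "'v set set"
  assumes "adjacent_matchings E M M'"
  obtains c :: "'v set \<Rightarrow> real" and b where "\<And>A. matching E A \<Longrightarrow> sum c A \<le> b"
    "\<And>A. matching E A \<Longrightarrow> sum c A = b \<longleftrightarrow> A = M \<or> A = M'"
proof -
  obtain c :: "'v set \<Rightarrow> real" and b where
    c: "\<forall>A. matching E A \<longrightarrow> sum c A \<le> b \<and> (sum c A = b \<longleftrightarrow> A = M \<or> A = M')"
    using assms unfolding adjacent_matchings_def by (elim conjE exE)
  show thesis
    by (rule that[of c b]) (simp_all add: c)
qed

lemma adjacent_matchings_sym: "adjacent_matchings E M M' \<Longrightarrow> adjacent_matchings E M' M"
  unfolding adjacent_matchings_def by (simp add: disj_commute eq_commute conj_ac)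

section \<open>The skeleton of the matching polytope\<close>

lemma inner_incidence_vector:
  fixes a :: "real ^ ('v::finite set)"
  shows "a \<bullet> incidence_vector A = (\<Sum>e\<in>A. a $ e)"
proof -
  have "a \<bullet> incidence_vector A = (\<Sum>e\<in>UNIV. if e \<in> A then a $ e else 0)"
    by (simp add: inner_vec_def incidence_vector_def if_distrib cong: if_cong)
  then show ?thesis
    by (simp add: sum.If_cases)
qed

lemma inj_incidence_vector: "inj (incidence_vector :: 'v::finite set set \<Rightarrow> _)"
proof (rule injI)
  fix A B :: "'v set set"
  assume "incidence_vector A = incidence_vector B"
  then have "(if e \<in> A then 1 else 0 :: real) = (if e \<in> B then 1 else 0)" for e
    by (simp add: incidence_vector_def vec_eq_iff)
  then show "A = B"
    by (metis subsetI subset_antisym zero_neq_one)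
qed

lemma incidence_vector_in_matching_polytope:
  "matching E A \<Longrightarrow> incidence_vector A \<in> matching_polytope E"
  unfolding matching_polytope_def by (simp add: hull_inc)

lemma polytope_matching_polytope: "polytope (matching_polytope E)"
  unfolding matching_polytope_def by (simp add: polytope_convex_hull)

text \<open>A supporting hyperplane cuts out a face, and any face of the hull of a compact set is
  the hull of some of its points. Those points lie on the hyperplane, which gives the nontrivial
  inclusion.\<close>

lemma supporting_face_convex_hull:
  fixes S :: "'a::euclidean_space set"
  assumes "finite S" "\<And>x. x \<in> S \<Longrightarrow> a \<bullet> x \<le> b"
  shows "convex hull {x \<in> S. a \<bullet> x = b} face_of convex hull S"
proof -
  have "S \<subseteq> {x. a \<bullet> x \<le> b}"
    using assms(2) by auto
  then have le: "convex hull S \<subseteq> {x. a \<bullet> x \<le> b}"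
    by (simp add: convex_halfspace_le hull_minimal)
  define F where "F = convex hull S \<inter> {x. a \<bullet> x = b}"
  have F: "F face_of convex hull S"
    unfolding F_def using le by (intro face_of_Int_supporting_hyperplane_le) auto
  then obtain T where T: "T \<subseteq> S" "F = convex hull T"
    using face_of_convex_hull_subset[of S F] finite_imp_compact[OF assms(1)] by blast
  have "T \<subseteq> {x \<in> S. a \<bullet> x = b}"
    using T hull_subset[of T convex] by (auto simp: F_def)
  then have "F \<subseteq> convex hull {x \<in> S. a \<bullet> x = b}"
    using T(2) by (simp add: hull_mono)
  moreover have "convex hull {x \<in> S. a \<bullet> x = b} \<subseteq> F"
  proof (rule hull_minimal)
    show "{x \<in> S. a \<bullet> x = b} \<subseteq> F"
      by (auto simp: F_def hull_inc)
    show "convex F"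
      using F face_of_imp_convex by blast
  qed
  ultimately show ?thesis
    using F by simp
qed

text \<open>An edge weighting is a linear functional evaluated at incidence vectors, so its
  maximisers span a face; if no matching attains \<open>b\<close>, the face is empty.\<close>

lemma matching_polytope_face_of_weight:
  fixes c :: "'v::finite set \<Rightarrow> real"
  assumes "\<And>A. matching E A \<Longrightarrow> sum c A \<le> b"
  shows "convex hull (incidence_vector ` {A. matching E A \<and> sum c A = b})
           face_of matching_polytope E"
proof -
  define a :: "real ^ ('v set)" where "a = (\<chi> e. c e)"
  have a: "a \<bullet> incidence_vector A = sum c A" for A
    by (simp add: inner_incidence_vector a_def)
  have "{x \<in> incidence_vector ` {A. matching E A}. a \<bullet> x = b}
      = incidence_vector ` {A. matching E A \<and> sum c A = b}"
    by (auto simp: a)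
  moreover have "a \<bullet> x \<le> b" if "x \<in> incidence_vector ` {A. matching E A}" for x
    using that assms by (auto simp: a)
  ultimately show ?thesis
    using supporting_face_convex_hull[of "incidence_vector ` {A. matching E A}" a b]
    by (simp add: matching_polytope_def)
qed

lemma skeleton_vertices_matching_polytope:
  fixes E :: "'v::finite set set"
  shows "skeleton_vertices (matching_polytope E) = incidence_vector ` {M. matching E M}"
proof
  show "skeleton_vertices (matching_polytope E) \<subseteq> incidence_vector ` {M. matching E M}"
    unfolding skeleton_vertices_def matching_polytope_def
    using extreme_point_of_convex_hull by blast
  show "incidence_vector ` {M. matching E M} \<subseteq> skeleton_vertices (matching_polytope E)"
  proof clarify
    fix M assume M: "matching E M"
    \<comment> \<open>Rewarding the edges of \<open>M\<close> and penalising all others makes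
      \<open>M\<close> the unique maximiser, so its vector alone forms a face.\<close>
    define c :: "'v set \<Rightarrow> real" where "c e = (if e \<in> M then 1 else -1)" for e
    have c: "sum c A = real (card (A \<inter> M)) - real (card (A - M))" for A
      unfolding c_def by (simp add: sum.If_cases Diff_eq)
    have le: "sum c A \<le> card M" for A
      using card_mono[of M "A \<inter> M"] by (simp add: c)
    have "A = M" if "sum c A = card M" for A
    proof -
      have "card (A \<inter> M) \<le> card M"
        by (simp add: card_mono)
      with that have "card (A \<inter> M) = card M" "card (A - M) = 0"
        unfolding c by linarith+
      moreover from this(1) have "A \<inter> M = M"
        by (metis card_subset_eq finite inf_le2)
      ultimately show ?thesis
        by auto
    qed
    moreover have "sum c M = card M"
      by (simp add: c)
    ultimately have "{A. matching E A \<and> sum c A = card M} = {M}"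
      using M by auto
    with matching_polytope_face_of_weight[of E c "card M"] le
    show "incidence_vector M \<in> skeleton_vertices (matching_polytope E)"
      by (simp add: skeleton_vertices_def face_of_singleton)
  qed
qed

lemma edge_of_matching_polytope_iff:
  fixes E :: "'v::finite set set"
  assumes M: "matching E M" and M': "matching E M'"
  shows "closed_segment (incidence_vector M) (incidence_vector M') edge_of matching_polytope E
    \<longleftrightarrow> adjacent_matchings E M M'" (is "?S edge_of ?P \<longleftrightarrow> _")
proof
  assume edge: "?S edge_of ?P"
  then have "aff_dim ?S = 1" and face: "?S face_of ?P"
    by (auto simp: edge_of_def)
  then have "M \<noteq> M'"
    by auto
  \<comment> \<open>Every face of a polyhedron is exposed; the coordinates of the exposing
    functional are the required weights.\<close>
  have "?S exposed_face_of ?P"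
    using face exposed_face_of_polyhedron polytope_imp_polyhedron polytope_matching_polytope
    by blast
  then obtain a b where ab: "?P \<subseteq> {x. a \<bullet> x \<le> b}" "?S = ?P \<inter> {x. a \<bullet> x = b}"
    unfolding exposed_face_of_def by blast
  have "(\<Sum>e\<in>A. a $ e) \<le> b \<and> ((\<Sum>e\<in>A. a $ e) = b \<longleftrightarrow> A = M \<or> A = M')" if A: "matching E A" for A
  proof -
    have P: "incidence_vector A \<in> ?P"
      using A by (rule incidence_vector_in_matching_polytope)
    have ext: "incidence_vector A extreme_point_of ?P"
      using A skeleton_vertices_matching_polytope[of E] by (auto simp: skeleton_vertices_def)
    \<comment> \<open>An extreme point of the polytope cannot lie in the open segment between two of
      its points, so on this segment it is an endpoint.\<close>
    have "incidence_vector A \<in> ?S \<longleftrightarrow> A = M \<or> A = M'"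
    proof
      assume "incidence_vector A \<in> ?S"
      then have "incidence_vector A = incidence_vector M \<or> incidence_vector A = incidence_vector M'"
        using ext incidence_vector_in_matching_polytope[OF M]
          incidence_vector_in_matching_polytope[OF M']
        unfolding extreme_point_of_def open_segment_def by blast
      then show "A = M \<or> A = M'"
        by (simp add: inj_eq[OF inj_incidence_vector])
    qed auto
    then show ?thesis
      using ab P by (auto simp: inner_incidence_vector)
  qed
  then show "adjacent_matchings E M M'"
    unfolding adjacent_matchings_def using M M' \<open>M \<noteq> M'\<close> by blast
next
  assume adj: "adjacent_matchings E M M'"
  then have "M \<noteq> M'"
    by (simp add: adjacent_matchings_def)
  obtain c :: "'v set \<Rightarrow> real" and b where
    c: "\<And>A. matching E A \<Longrightarrow> sum c A \<le> b"
      "\<And>A. matching E A \<Longrightarrow> sum c A = b \<longleftrightarrow> A = M \<or> A = M'"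
    using adjacent_matchings_weightE[OF adj] by blast
  have "{A. matching E A \<and> sum c A = b} = {M, M'}"
    using c(2) M M' by blast
  with matching_polytope_face_of_weight[of E c b] c(1)
  have "?S face_of ?P"
    by (simp add: segment_convex_hull)
  moreover have "aff_dim ?S = 1"
    using \<open>M \<noteq> M'\<close> by (simp add: segment_convex_hull aff_dim_convex_hull aff_dim_2 inj_eq[OF inj_incidence_vector])
  ultimately show "?S edge_of ?P"
    by (simp add: edge_of_def)
qed

text \<open>Skeleton edges are unordered pairs, so an edge at \<open>M\<close> is determined by its
  other end, and incidence vectors determine their matchings.\<close>

lemma matching_degree_eq_card_adjacent:
  fixes E :: "'v::finite set set"
  assumes M: "matching E M"
  shows "matching_degree E M = card {M'. adjacent_matchings E M M'}"
proof -
  let ?P = "matching_polytope E" and ?v = "incidence_vector :: 'v set set \<Rightarrow> _"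
  have "{d \<in> skeleton_edges ?P. ?v M \<in> d} = (\<lambda>M'. {?v M, ?v M'}) ` {M'. adjacent_matchings E M M'}"
  proof (intro equalityI subsetI)
    fix d assume "d \<in> {d \<in> skeleton_edges ?P. ?v M \<in> d}"
    then obtain A B where AB: "matching E A" "matching E B" "d = {?v A, ?v B}"
        "closed_segment (?v A) (?v B) edge_of ?P" "?v M = ?v A \<or> ?v M = ?v B"
      by (auto simp: skeleton_edges_def skeleton_vertices_matching_polytope)
    then have "adjacent_matchings E A B" "M = A \<or> M = B"
      by (auto simp: edge_of_matching_polytope_iff inj_eq[OF inj_incidence_vector])
    with AB(3) show "d \<in> (\<lambda>M'. {?v M, ?v M'}) ` {M'. adjacent_matchings E M M'}"
      using adjacent_matchings_sym by blast
  next
    fix d assume "d \<in> (\<lambda>M'. {?v M, ?v M'}) ` {M'. adjacent_matchings E M M'}"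
    then obtain M' where M': "adjacent_matchings E M M'" "d = {?v M, ?v M'}"
      by blast
    then have "matching E M'"
      by (simp add: adjacent_matchings_def)
    with M M' show "d \<in> {d \<in> skeleton_edges ?P. ?v M \<in> d}"
      unfolding skeleton_edges_def skeleton_vertices_matching_polytope
      using edge_of_matching_polytope_iff[OF M, of M'] by blast
  qed
  moreover have "inj_on (\<lambda>M'. {?v M, ?v M'}) {M'. adjacent_matchings E M M'}"
    by (rule inj_onI) (auto simp: doubleton_eq_iff inj_eq[OF inj_incidence_vector])
  ultimately show ?thesis
    by (simp add: matching_degree_def degree_in_def card_image)
qed

section \<open>Adding one edge\<close>

lemma matching_subset: "matching E A \<Longrightarrow> B \<subseteq> A \<Longrightarrow> matching E B"
  unfolding matching_def by (meson order_trans pairwise_subset)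

lemma matching_insert_iff:
  "e \<notin> A \<Longrightarrow> matching E (insert e A) \<longleftrightarrow> e \<in> E \<and> matching E A \<and> e \<inter> \<Union>A = {}"
  unfolding matching_def pairwise_insert by (auto simp: disjnt_def)

text \<open>Disjoint edges cover each vertex of \<open>S\<close> at most once. This lets rewards on
  vertices be encoded as edge weights.\<close>

lemma sum_card_Int_matching:
  fixes A :: "'v::finite set set"
  assumes "matching E A"
  shows "(\<Sum>f\<in>A. card (f \<inter> S)) = card (S \<inter> \<Union>A)"
proof -
  have "S \<inter> \<Union>A = (\<Union>f\<in>A. f \<inter> S)"
    by auto
  moreover have "card (\<Union>f\<in>A. f \<inter> S) = (\<Sum>f\<in>A. card (f \<inter> S))"
    using assms by (intro card_UN_disjoint) (auto simp: matching_def pairwise_def disjnt_def)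
  ultimately show ?thesis
    by simp
qed

text \<open>Otherwise \<open>insert e M\<close> is not optimal, which forces \<open>c e < 0\<close>;
  then deleting \<open>e\<close> from the optimal \<open>M'\<close> would exceed the
  maximum.\<close>

lemma adjacent_matchings_containing_new_edge:
  fixes E :: "'v::finite set set"
  assumes adj: "adjacent_matchings E M M'" and N: "matching E (insert e M)" and "e \<notin> M"
    and "e \<in> M'"
  shows "M' = insert e M"
proof (rule ccontr)
  assume neq: "M' \<noteq> insert e M"
  obtain c :: "'v set \<Rightarrow> real" and b where c: "\<And>A. matching E A \<Longrightarrow> sum c A \<le> b"
      "\<And>A. matching E A \<Longrightarrow> sum c A = b \<longleftrightarrow> A = M \<or> A = M'"
    using adjacent_matchings_weightE[OF adj] by blast
  have M: "matching E M" and M': "matching E M'"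
    using adj by (simp_all add: adjacent_matchings_def)
  have "sum c (insert e M) < b"
    using c[OF N] neq \<open>e \<notin> M\<close> by (metis insertI1 order_le_imp_less_or_eq)
  moreover have "sum c (insert e M) = c e + sum c M"
    using \<open>e \<notin> M\<close> by simp
  moreover have "sum c M = b" "sum c M' = b"
    using c(2) M M' by auto
  moreover have "sum c M' = c e + sum c (M' - {e})"
    using \<open>e \<in> M'\<close> by (simp add: sum.remove)
  moreover have "sum c (M' - {e}) \<le> b"
    using c(1) matching_subset[OF M'] by blast
  ultimately show False
    by linarith
qed

lemma adjacent_matchings_insert:
  fixes E :: "'v::finite set set"
  assumes adj: "adjacent_matchings E M M'" and N: "matching E (insert e M)"
    and eM: "e \<notin> M" and eM': "e \<notin> M'"
  shows "adjacent_matchings E (insert e M) (if e \<inter> \<Union>M' = {} then insert e M' else M')"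
    (is "adjacent_matchings E ?N ?N'")
proof -
  obtain c :: "'v set \<Rightarrow> real" and b where c: "\<And>A. matching E A \<Longrightarrow> sum c A \<le> b"
      "\<And>A. matching E A \<Longrightarrow> sum c A = b \<longleftrightarrow> A = M \<or> A = M'"
    using adjacent_matchings_weightE[OF adj] by blast
  have M: "matching E M" and M': "matching E M'" and "M \<noteq> M'"
    using adj by (simp_all add: adjacent_matchings_def)
  have e: "e \<in> E" "e \<inter> \<Union>M = {}"
    using N eM by (auto simp: matching_insert_iff)
  have N': "matching E ?N'"
    using M' eM' e by (simp add: matching_insert_iff)
  have "?N \<noteq> ?N'"
    using \<open>M \<noteq> M'\<close> eM eM' by (auto simp: insert_ident)
  define S where "S = e \<inter> \<Union>M'"
  \<comment> \<open>If \<open>S\<close> is nonempty, \<open>k\<close> is the full reward, so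
    \<open>M'\<close> ties with matchings using \<open>e\<close>. If \<open>S\<close> is empty, the
    value 1 makes every matching avoiding \<open>e\<close> strictly worse.\<close>
  define k where "k = max 1 (real (card S))"
  define c' where "c' f = (if f = e then k else c f + real (card (f \<inter> S)))" for f
  have without: "sum c' A = sum c A + real (card (S \<inter> \<Union>A))" if "matching E A" "e \<notin> A" for A
  proof -
    have "sum c' A = (\<Sum>f\<in>A. c f + real (card (f \<inter> S)))"
      using that(2) by (intro sum.cong) (auto simp: c'_def)
    also have "\<dots> = sum c A + real (\<Sum>f\<in>A. card (f \<inter> S))"
      by (simp add: sum.distrib)
    finally show ?thesis
      using sum_card_Int_matching[OF that(1)] by simp
  qed
  have "sum c' A \<le> b + k \<and> (sum c' A = b + k \<longleftrightarrow> A = ?N \<or> A = ?N')" if A: "matching E A" for A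
  proof (cases "e \<in> A")
    case True
    define B where "B = A - {e}"
    have AB: "A = insert e B" "e \<notin> B"
      using True by (auto simp: B_def)
    then have B: "matching E B" "e \<inter> \<Union>B = {}"
      using A by (auto simp: matching_insert_iff)
    \<comment> \<open>The other edges of \<open>A\<close> miss both ends of \<open>e\<close>, so
      they earn no reward and are compared by the old weights alone. The case \<open>B = M'\<close>
      arises only for empty \<open>S\<close>.\<close>
    have "S \<inter> \<Union>B = {}"
      using B(2) by (auto simp: S_def)
    then have "sum c' A = k + sum c B"
      using without[OF B(1) AB(2)] AB by (simp add: c'_def)
    moreover have "A = ?N \<or> A = ?N' \<longleftrightarrow> B = M \<or> B = M'"
      using AB eM eM' B(2) by (auto simp: insert_ident)
    ultimately show ?thesis
      using c[OF B(1)] by auto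
  next
    case False
    have card: "card (S \<inter> \<Union>A) \<le> card S"
      by (simp add: card_mono)
    \<comment> \<open>Equality needs both the old maximum and a reward of \<open>k \<ge> 1\<close>.
      So \<open>A\<close> meets \<open>e\<close>, which rules out \<open>M\<close> and leaves
      \<open>M'\<close>.\<close>
    have "sum c' A = b + k \<longleftrightarrow> S \<noteq> {} \<and> A = M'"
    proof
      assume "sum c' A = b + k"
      then have *: "sum c A = b" "real (card (S \<inter> \<Union>A)) = k"
        using without[OF A False] c(1)[OF A] card unfolding k_def by linarith+
      then have "S \<inter> \<Union>A \<noteq> {}"
        by (auto simp: k_def)
      then have "S \<noteq> {}" "A \<noteq> M"
        using e(2) by (auto simp: S_def)
      with * show "S \<noteq> {} \<and> A = M'"
        using c(2)[OF A] by blast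
    next
      assume *: "S \<noteq> {} \<and> A = M'"
      then have "S \<inter> \<Union>A = S" "card S \<ge> 1"
        by (auto simp: S_def Suc_le_eq card_gt_0_iff)
      with * show "sum c' A = b + k"
        using without[OF A False] c(2)[OF A] by (simp add: k_def)
    qed
    moreover have "A = ?N \<or> A = ?N' \<longleftrightarrow> S \<noteq> {} \<and> A = M'"
      using False by (auto simp: S_def)
    moreover have "sum c' A \<le> b + k"
      using without[OF A False] c(1)[OF A] card unfolding k_def by linarith
    ultimately show ?thesis
      by blast
  qed
  then show ?thesis
    unfolding adjacent_matchings_def using N N' \<open>?N \<noteq> ?N'\<close> by blast
qed

section \<open>Comparison of degrees\<close>

lemma matching_degree_insert:
  fixes E :: "'v::finite set set"
  assumes N: "matching E (insert e M)" and eM: "e \<notin> M"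
  shows "matching_degree E M \<le> matching_degree E (insert e M)"
proof -
  have M: "matching E M"
    using N by (rule matching_subset) blast
  \<comment> \<open>The only neighbour containing \<open>e\<close> is \<open>insert e M\<close>
    itself; by symmetry of adjacency it is replaced by \<open>M\<close>.\<close>
  define g where "g M' = (if e \<in> M' then M else if e \<inter> \<Union>M' = {} then insert e M' else M')" for M'
  note new = adjacent_matchings_containing_new_edge[OF _ N eM]
  have "inj_on g {M'. adjacent_matchings E M M'}"
  proof (rule inj_on_inverseI)
    fix A assume "A \<in> {M'. adjacent_matchings E M M'}"
    then have "adjacent_matchings E M A" "A \<noteq> M"
      by (auto simp: adjacent_matchings_def)
    \<comment> \<open>The value \<open>M\<close> arises only from \<open>insert e M\<close>, since
      the other values are distinct from \<open>M\<close>. In all other cases deleting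
      \<open>e\<close> recovers \<open>A\<close>, harmlessly so when \<open>e\<close> was not
      added.\<close>
    then show "(if g A = M then insert e M else g A - {e}) = A"
      using new eM by (cases "e \<in> A") (simp_all add: g_def, blast)
  qed
  moreover have "g ` {M'. adjacent_matchings E M M'} \<subseteq> {N'. adjacent_matchings E (insert e M) N'}"
  proof clarify
    fix M' assume adj: "adjacent_matchings E M M'"
    show "adjacent_matchings E (insert e M) (g M')"
    proof (cases "e \<in> M'")
      case True
      then show ?thesis
        using new[OF adj True] adjacent_matchings_sym[OF adj] by (simp add: g_def)
    next
      case False
      then show ?thesis
        using adjacent_matchings_insert[OF adj N eM] by (simp add: g_def)
    qed
  qed
  ultimately have "card {M'. adjacent_matchings E M M'}
      \<le> card {N'. adjacent_matchings E (insert e M) N'}"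
    by (intro card_inj_on_le) auto
  then show ?thesis
    using M N by (simp add: matching_degree_eq_card_adjacent)
qed

theorem theorem3p1:
  fixes V :: "'v::finite set" and E M N :: "'v set set"
  assumes "simple_graph V E"
    and "matching E M" and "matching E N"
    and "M \<subseteq> N"
  shows "matching_degree E M \<le> matching_degree E N"
  using \<open>M \<subseteq> N\<close> \<open>matching E N\<close>
proof (induction "card (N - M)" arbitrary: N)
  case 0
  then show ?case
    by simp
next
  case (Suc n)
  \<comment> \<open>Removing \<open>e\<close> leaves a matching that still contains \<open>M\<close>
    and falls under the induction hypothesis; restoring \<open>e\<close> is the one-edge
    case.\<close>
  then obtain e where e: "e \<in> N" "e \<notin> M"
    by (metis DiffE card.empty ex_in_conv nat.distinct(1))
  have N: "insert e (N - {e}) = N"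
    using e by auto
  have "n = card (N - {e} - M)"
    using Suc.hyps(2) e by (metis Diff_insert Diff_insert2 DiffI card_Diff_singleton diff_Suc_1)
  then have "matching_degree E M \<le> matching_degree E (N - {e})"
    using Suc e matching_subset[of E N "N - {e}"] by blast
  also have "\<dots> \<le> matching_degree E N"
    using matching_degree_insert[of E e "N - {e}"] N Suc.prems(2) by simp
  finally show ?case .
qed

end
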